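(* Let $m\ge n>k\ge1$ and let $R=\begin{pmatrix}A&B\\ C&D\end{pmatrix}$ be a real $m\times n$ matrix with $A$ of size $k\times k$, $B$ of size $k\times (n-k)$, $C$ of size $(m-k)\times k$ and $D$ of size $(m-k)\times(n-k)$. Let $R_0=\begin{pmatrix}A&B\\ C&0\end{pmatrix}$. If $A$ is invertible, then $$\sigma_{k+1}(R_0)\le\min\left\{\frac{\|CA^{-1}\|}{\sqrt{1+\|CA^{-1}\|^2}}\|B\|,\ \frac{\|A^{-1}B\|}{\sqrt{1+\|A^{-1}B\|^2}}\|C\|\right\}\le\frac{\|B\|\,\|C\|}{\sqrt{\sigma_k(A)^2+\max\{\|B\|,\|C\|\}^2}}$$ and $$\sigma_{k+1}(R)\le\min\left\{\frac{\|CA^{-1}\|}{\sqrt{1+\|CA^{-1}\|^2}}\|B\|+\rho_2,\ \frac{\|A^{-1}B\|}{\sqrt{1+\|A^{-1}B\|^2}}\|C\|+\rho_1\right\},$$ where $\rho_1,\rho_2$ are defined in the context.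
   Context: $\|\cdot\|$ is the operator (spectral) norm and $\sigma_1\ge\sigma_2\ge\cdots$ are singular values in decreasing order. Let $r=\operatorname{rank}(B)$, $l=\operatorname{rank}(C)$, $$\nu_1=\frac1{\sqrt{1+\sigma_r(A^{-1}B)^2}},\qquad \nu_2=\frac1{\sqrt{1+\sigma_l(CA^{-1})^2}},$$ $$\rho_1=\nu_1\|D\|+(1-\nu_1)\,\|D|_{\ker B}\|,\qquad \rho_2=\nu_2\|D\|+(1-\nu_2)\,\|D^T|_{\ker C^T}\|,$$ where $D|_{\ker B}$ denotes the restriction of the linear map $D$ to the subspace $\ker B$ (the norm of a restriction to the zero subspace being $0$). If $B=0$ then $\rho_1=\|D\|$ (whatever value is assigned to $\nu_1$), and if $C=0$ then $\rho_2=\|D\|$. *)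

theory Defs
  imports "HOL-Analysis.Analysis" "HOL-Library.Multiset"
begin

definition block_mat ::
  "real^'k^'k \<Rightarrow> real^'p^'k \<Rightarrow> real^'k^'q \<Rightarrow> real^'p^'q \<Rightarrow> real^('k + 'p)^('k + 'q)" where
  "block_mat A B C D = (\<chi> i j. case i of
      Inl i' \<Rightarrow> (case j of Inl j' \<Rightarrow> A $ i' $ j' | Inr j' \<Rightarrow> B $ i' $ j')
    | Inr i' \<Rightarrow> (case j of Inl j' \<Rightarrow> C $ i' $ j' | Inr j' \<Rightarrow> D $ i' $ j'))"

abbreviation op_norm :: "real^'n^'m \<Rightarrow> real" where
  "op_norm M \<equiv> onorm (\<lambda>x. M *v x)"

text \<open>The same supremum as in the library's \<^const>\<open>onorm\<close>, taken over a subspace.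
  Since \<^prop>\<open>0 / 0 = (0::real)\<close>, the value on the zero subspace is 0.\<close>

definition onorm_on :: "'a::real_normed_vector set \<Rightarrow> ('a \<Rightarrow> 'b::real_normed_vector) \<Rightarrow> real" where
  "onorm_on S f = (SUP x\<in>S. norm (f x) / norm x)"

definition ker :: "real^'n^'m \<Rightarrow> (real^'n) set" where
  "ker M = {x. M *v x = 0}"

definition sing_space :: "real^'n^'m \<Rightarrow> real \<Rightarrow> (real^'n) set" where
  "sing_space M s = {x. (transpose M ** M) *v x = s\<^sup>2 *\<^sub>R x}"

text \<open>The square roots of the eigenvalues of \<open>M\<^sup>T M\<close>, each counted with the dimension of its
  eigenspace (for a symmetric matrix, the geometric and algebraic multiplicities agree).
  For an \<open>m \<times> n\<close> matrix this gives \<open>n\<close> values: if \<open>m < n\<close>, the \<open>min m n\<close> singular values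
  followed by \<open>n - m\<close> further zeros.\<close>

definition sing_mset :: "real^'n^'m \<Rightarrow> real multiset" where
  "sing_mset M = (\<Sum>s | 0 \<le> s \<and> (\<exists>x\<in>sing_space M s. x \<noteq> 0).
     replicate_mset (dim (sing_space M s)) s)"

text \<open>Numbering starts at 1; indices out of range give 0.\<close>

definition sing_val :: "real^'n^'m \<Rightarrow> nat \<Rightarrow> real" where
  "sing_val M j = (if 1 \<le> j \<and> j \<le> size (sing_mset M)
     then rev (sorted_list_of_multiset (sing_mset M)) ! (j - 1) else 0)"

text \<open>The index set of the sum in \<open>sing_mset\<close> is finite, so the multiplicities are as intended.\<close>

lemma finite_sing: "finite {s. 0 \<le> s \<and> (\<exists>x\<in>sing_space (M :: real^'n^'m) s. x \<noteq> 0)}"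
    (is "finite ?S")
proof -
  define f where "f s = (SOME x. x \<in> sing_space M s \<and> x \<noteq> 0)" for s
  have f: "f s \<in> sing_space M s \<and> f s \<noteq> 0" if "s \<in> ?S" for s
    unfolding f_def by (rule someI_ex) (use that in auto)
  have orth: "f s \<bullet> f t = 0" if "s \<in> ?S" "t \<in> ?S" "s \<noteq> t" for s t
  proof -
    let ?H = "transpose M ** M"
    have "(?H *v f s) \<bullet> f t = f s \<bullet> (?H *v f t)"
      by (simp add: dot_lmul_matrix[symmetric] matrix_transpose_mul
          flip: transpose_matrix_vector)
    then have "s\<^sup>2 * (f s \<bullet> f t) = t\<^sup>2 * (f s \<bullet> f t)"
      using f[OF that(1)] f[OF that(2)] by (simp add: sing_space_def)
    moreover have "s\<^sup>2 \<noteq> t\<^sup>2"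
      using that by simp
    ultimately show ?thesis by simp
  qed
  have inj: "inj_on f ?S"
    using orth f by (metis (no_types, lifting) inj_onI inner_eq_zero_iff)
  have "pairwise orthogonal (f ` ?S)"
    using orth by (auto simp: pairwise_def orthogonal_def)
  moreover have "0 \<notin> f ` ?S"
    using f by force
  ultimately have "finite (f ` ?S)"
    using pairwise_orthogonal_independent independent_imp_finite by blast
  then show ?thesis
    using inj finite_imageD by blast
qed

lemma count_sing_mset:
  "count (sing_mset M) s = (if 0 \<le> s then dim (sing_space M s) else 0)"
proof -
  have "count (sing_mset M) s =
      (if 0 \<le> s \<and> (\<exists>x\<in>sing_space M s. x \<noteq> 0) then dim (sing_space M s) else 0)"
    unfolding sing_mset_def using finite_sing[of M]
    by (simp add: count_sum sum.delta)
  moreover have "dim (sing_space M s) = 0" if "\<not> (\<exists>x\<in>sing_space M s. x \<noteq> 0)"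
    using that by auto
  ultimately show ?thesis by auto
qed

definition nu1 :: "real^'k^'k \<Rightarrow> real^'p^'k \<Rightarrow> real" where
  "nu1 A B = 1 / sqrt (1 + (sing_val (matrix_inv A ** B) (rank B))\<^sup>2)"

definition nu2 :: "real^'k^'k \<Rightarrow> real^'k^'q \<Rightarrow> real" where
  "nu2 A C = 1 / sqrt (1 + (sing_val (C ** matrix_inv A) (rank C))\<^sup>2)"

text \<open>If \<open>B = 0\<close>, then \<open>ker B\<close> is the whole space and \<open>rho1 A B D = op_norm D\<close>
  whatever the value of \<open>nu1 A B\<close>; likewise for \<open>rho2\<close> if \<open>C = 0\<close>.\<close>

definition rho1 :: "real^'k^'k \<Rightarrow> real^'p^'k \<Rightarrow> real^'p^'q \<Rightarrow> real" where
  "rho1 A B D = nu1 A B * op_norm D + (1 - nu1 A B) * onorm_on (ker B) (\<lambda>x. D *v x)"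

definition rho2 :: "real^'k^'k \<Rightarrow> real^'k^'q \<Rightarrow> real^'p^'q \<Rightarrow> real" where
  "rho2 A C D = nu2 A C * op_norm D
     + (1 - nu2 A C) * onorm_on (ker (transpose C)) (\<lambda>x. transpose D *v x)"

lemma rho1_zero: "rho1 A 0 D = op_norm D"
  by (simp add: rho1_def ker_def onorm_on_def onorm_def algebra_simps)

end

theory Submission imports Defs begin

text \<open>
  If \<open>\<sigma>\<^sub>j > 0\<close>, the eigenspaces of \<open>M\<^sup>T M\<close> for singular values at least \<open>\<sigma>\<^sub>j\<close> span a subspace \<open>E\<close>
  orthogonal to \<open>ker M\<close>, of dimension at least \<open>j\<close>, on which \<open>M\<close> stretches by at least \<open>\<sigma>\<^sub>j\<close>. Intersecting
  \<open>E\<close> with the kernel of a linear map into \<open>\<real>\<^sup>k\<close> bounds the singular value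
  number \<open>k + 1\<close> by the norm of \<open>M\<close> on that kernel; comparing \<open>E\<close> with the orthogonal complement of \<open>ker M\<close> bounds \<open>M\<close> from below there.

  The kernel of \<open>(A B)\<close> consists of the vectors \<open>(-A\<^sup>-\<^sup>1 B v, v)\<close>, which \<open>R\<close> maps to
  \<open>(0, D v - C A\<^sup>-\<^sup>1 B v)\<close>; this gives the bound with \<open>\<rho>\<^sub>1\<close>. The bound with \<open>\<rho>\<^sub>2\<close> is obtained from
  \<open>R\<^sup>T\<close>, whose norm on the kernel of \<open>(A\<^sup>T C\<^sup>T)\<close> controls \<open>R\<close> on the preimage of that kernel under \<open>R\<close>.
\<close>

section \<open>Eigenspaces of \<open>transpose M ** M\<close> and bounds for singular values\<close>

lemma inner_transpose_mult: "(transpose M *v x) \<bullet> y = x \<bullet> (M *v y)"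
  for M :: "real^'n^'m"
  by (simp add: dot_lmul_matrix)

lemma sing_space_inner:
  assumes "x \<in> sing_space M t"
  shows "(M *v x) \<bullet> (M *v y) = t\<^sup>2 * (x \<bullet> y)"
proof -
  have "(M *v x) \<bullet> (M *v y) = ((transpose M ** M) *v x) \<bullet> y"
    by (metis inner_transpose_mult matrix_vector_mul_assoc inner_commute)
  then show ?thesis
    using assms by (simp add: sing_space_def)
qed

lemma subspace_sing_space: "subspace (sing_space M t)"
  by (auto simp: sing_space_def subspace_def matrix_vector_right_distrib
      matrix_vector_mult_scaleR scaleR_add_right)

lemma sing_space_orthogonal:
  assumes "x \<in> sing_space M s" "y \<in> sing_space M t" "0 \<le> s" "0 \<le> t" "s \<noteq> t"
  shows "x \<bullet> y = 0"
proof -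
  have "s\<^sup>2 * (x \<bullet> y) = t\<^sup>2 * (x \<bullet> y)"
    using sing_space_inner[OF assms(1), of y] sing_space_inner[OF assms(2), of x]
    by (simp add: inner_commute)
  moreover have "s\<^sup>2 \<noteq> t\<^sup>2"
    using assms by simp
  ultimately show ?thesis by simp
qed

text \<open>The reversed sorted list is decreasing, so its first \<open>j\<close> positions all
  carry at least the entry at position \<open>j - 1\<close>. Counting positions instead of values
  takes care of repetitions.\<close>

lemma le_size_filter_nth_rev_sorted:
  assumes "1 \<le> j" "j \<le> size A"
  shows "j \<le> size (filter_mset (\<lambda>t. rev (sorted_list_of_multiset A) ! (j - 1) \<le> t) A)"
proof -
  define L where "L = rev (sorted_list_of_multiset A)"
  have A: "mset L = A"
    by (simp add: L_def)
  then have len: "length L = size A"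
    by (metis size_mset)
  have "L ! (j - 1) \<le> L ! i" if "i < j" for i
    using that assms len by (intro sorted_rev_nth_mono) (auto simp: L_def)
  then have "{..<j} \<subseteq> {i. i < length L \<and> L ! (j - 1) \<le> L ! i}"
    using assms len by auto
  then have "card {..<j} \<le> card {i. i < length L \<and> L ! (j - 1) \<le> L ! i}"
    by (intro card_mono) auto
  also have "\<dots> = length (filter (\<lambda>t. L ! (j - 1) \<le> t) L)"
    by (simp add: length_filter_conv_card)
  also have "\<dots> = size (filter_mset (\<lambda>t. L ! (j - 1) \<le> t) A)"
    by (metis A mset_filter size_mset)
  finally show ?thesis
    by (simp add: L_def)
qed

lemma sing_val_nonneg: "0 \<le> sing_val M j"
proof (cases "1 \<le> j \<and> j \<le> size (sing_mset M)")
  case True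
  define L where "L = rev (sorted_list_of_multiset (sing_mset M))"
  have len: "length L = size (sing_mset M)"
    by (simp add: L_def flip: size_mset)
  then have "L ! (j - 1) \<in> set L"
    using True by (intro nth_mem) auto
  then have "L ! (j - 1) \<in># sing_mset M"
    by (simp add: L_def)
  then have "0 \<le> L ! (j - 1)"
    by (metis count_sing_mset not_in_iff)
  then show ?thesis
    using True by (simp add: sing_val_def L_def)
qed (auto simp: sing_val_def)

text \<open>Orthogonal bases of the eigenspaces for the values \<open>t\<close> with
  \<open>sing_val M j \<le> t\<close> unite to an orthogonal set \<open>W\<close>, whose image under
  \<open>M\<close> is orthogonal too; \<open>E\<close> is its span. The dimension may exceed
  \<open>j\<close>, because a repeated value brings in its whole eigenspace.\<close>

lemma sing_val_eigenspan:
  fixes M :: "real^'n^'m"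
  assumes pos: "0 < sing_val M j"
  obtains E where "subspace E" "j \<le> dim E"
    "\<And>x. x \<in> E \<Longrightarrow> sing_val M j * norm x \<le> norm (M *v x)"
    "\<And>x y. x \<in> E \<Longrightarrow> y \<in> ker M \<Longrightarrow> x \<bullet> y = 0"
proof -
  define s where "s = sing_val M j"
  define T where "T = {t. s \<le> t \<and> t \<in># sing_mset M}"
  have s0: "0 < s"
    using pos s_def by simp
  have fin: "finite T"
    unfolding T_def by (rule finite_subset[of _ "set_mset (sing_mset M)"]) auto
  \<comment> \<open>A positive value cannot be the default 0, so the index is in range.\<close>
  have j: "1 \<le> j" "j \<le> size (sing_mset M)"
    using pos by (auto simp: sing_val_def split: if_splits)
  have "j \<le> size (filter_mset (\<lambda>t. s \<le> t) (sing_mset M))"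
    using le_size_filter_nth_rev_sorted[OF j] j by (simp add: s_def sing_val_def)
  also have "\<dots> = (\<Sum>t\<in>T. dim (sing_space M t))"
    using s0 by (auto simp: size_multiset_overloaded_eq T_def count_sing_mset intro!: sum.cong)
  finally have jle: "j \<le> (\<Sum>t\<in>T. dim (sing_space M t))" .
  have "\<exists>B. 0 \<notin> B \<and> B \<subseteq> sing_space M t \<and> pairwise orthogonal B \<and> independent B \<and>
      card B = dim (sing_space M t)" for t
    using orthogonal_basis_subspace[OF subspace_sing_space[of M t]] by metis
  then obtain U where U: "\<And>t. 0 \<notin> U t" "\<And>t. U t \<subseteq> sing_space M t"
      "\<And>t. pairwise orthogonal (U t)" "\<And>t. independent (U t)"
      "\<And>t. card (U t) = dim (sing_space M t)"
    by metis
  define W where "W = (\<Union>t\<in>T. U t)"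
  have Tpos: "0 < t" if "t \<in> T" for t
    using that s0 by (auto simp: T_def)
  have orth: "x \<bullet> y = 0" if "x \<in> U s" "y \<in> U t" "s \<in> T" "t \<in> T" "x \<noteq> y" for x y s t
  proof (cases "s = t")
    case True
    then show ?thesis
      using that U(3)[of t] by (auto simp: pairwise_def orthogonal_def)
  next
    case False
    then show ?thesis
      using that U(2) Tpos by (meson less_imp_le sing_space_orthogonal subsetD)
  qed
  have finU: "finite (U t)" for t
    using U(4) independent_imp_finite by blast
  have disj: "U s \<inter> U t = {}" if "s \<in> T" "t \<in> T" "s \<noteq> t" for s t
  proof -
    have "x = 0" if "x \<in> U s" "x \<in> U t" for x
      using sing_space_orthogonal[of x M s x t] that \<open>s \<in> T\<close> \<open>t \<in> T\<close> \<open>s \<noteq> t\<close> U(2) Tpos[of s] Tpos[of t]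
      by (auto dest!: subsetD[OF U(2)])
    then show ?thesis
      using U(1) by blast
  qed
  have pw: "pairwise orthogonal W"
    unfolding pairwise_def orthogonal_def W_def using orth by blast
  have indep: "independent W"
    using pw U(1) by (intro pairwise_orthogonal_independent) (auto simp: W_def)
  have finW: "finite W"
    using fin finU by (simp add: W_def)
  have "card W = (\<Sum>t\<in>T. card (U t))"
    unfolding W_def using fin finU disj by (intro card_UN_disjoint) auto
  then have jW: "j \<le> card W"
    using jle U(5) by simp
  \<comment> \<open>Because \<open>t\<close> is nonzero, \<open>w\<close> is orthogonal to
    \<open>y\<close> exactly when their images are orthogonal. This gives both the orthogonality to
    \<open>ker M\<close> and the orthogonality of the images of \<open>W\<close>.\<close>
  have WM: "s * norm w \<le> norm (M *v w)"
    and Wker: "w \<bullet> y = 0 \<longleftrightarrow> (M *v w) \<bullet> (M *v y) = 0" if "w \<in> W" for w y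
  proof -
    obtain t where t: "t \<in> T" "w \<in> sing_space M t"
      using \<open>w \<in> W\<close> U(2) by (auto simp: W_def)
    have "(norm (M *v w))\<^sup>2 = (t * norm w)\<^sup>2"
      using sing_space_inner[OF t(2), of w] by (simp add: power2_norm_eq_inner power_mult_distrib)
    then have "norm (M *v w) = t * norm w"
      using Tpos[OF t(1)] by simp
    moreover have "s * norm w \<le> t * norm w"
      using t by (intro mult_right_mono) (auto simp: T_def)
    ultimately show "s * norm w \<le> norm (M *v w)"
      by simp
    show "w \<bullet> y = 0 \<longleftrightarrow> (M *v w) \<bullet> (M *v y) = 0"
      using sing_space_inner[OF t(2), of y] Tpos[OF t(1)] by simp
  qed
  show thesis
  proof
    show "subspace (span W)" by simp
    show "j \<le> dim (span W)"
      using jW indep by (simp add: dim_eq_card_independent)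
    show "x \<bullet> y = 0" if "x \<in> span W" "y \<in> ker M" for x y
      using that(1)
    proof (induction rule: span_induct_alt)
      case (step c a b)
      then show ?case
        using Wker[of a y] \<open>y \<in> ker M\<close> by (simp add: ker_def inner_add_left)
    qed simp
    show "sing_val M j * norm x \<le> norm (M *v x)" if x_span: "x \<in> span W" for x
    proof -
      obtain u where x: "x = (\<Sum>w\<in>W. u w *\<^sub>R w)"
        using x_span unfolding span_finite[OF finW] by blast
      have Mx: "M *v x = (\<Sum>w\<in>W. M *v (u w *\<^sub>R w))"
        unfolding x by (rule linear_sum[OF matrix_vector_mul_linear])
      \<comment> \<open>Pythagoras is applied to \<open>x\<close> and to \<open>M *v x\<close>, and
        the two sums are compared term by term.\<close>
      have "(s * norm x)\<^sup>2 = s\<^sup>2 * (\<Sum>w\<in>W. (norm (u w *\<^sub>R w))\<^sup>2)"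
        unfolding x power_mult_distrib using pw
        by (subst norm_sum_Pythagorean[OF finW])
          (auto simp: pairwise_def orthogonal_def)
      also have "\<dots> = (\<Sum>w\<in>W. (s * norm w)\<^sup>2 * (u w)\<^sup>2)"
        by (simp add: sum_distrib_left power_mult_distrib algebra_simps)
      also have "\<dots> \<le> (\<Sum>w\<in>W. (norm (M *v w))\<^sup>2 * (u w)\<^sup>2)"
        using WM s0 by (intro sum_mono mult_right_mono power_mono) auto
      also have "\<dots> = (\<Sum>w\<in>W. (norm (M *v (u w *\<^sub>R w)))\<^sup>2)"
        by (simp add: matrix_vector_mult_scaleR power_mult_distrib mult.commute)
      also have "\<dots> = (norm (M *v x))\<^sup>2"
        unfolding Mx
      proof (rule norm_sum_Pythagorean[symmetric, OF finW])
        have "(M *v v) \<bullet> (M *v w) = 0" if "v \<in> W" "w \<in> W" "v \<noteq> w" for v w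
          using pw Wker[of v w] that by (auto simp: pairwise_def orthogonal_def)
        then show "pairwise (\<lambda>i j. orthogonal (M *v (u i *\<^sub>R i)) (M *v (u j *\<^sub>R j))) W"
          by (auto simp: pairwise_def orthogonal_def matrix_vector_mult_scaleR)
      qed
      finally show ?thesis
        using s_def norm_ge_zero power2_le_imp_le by blast
    qed
  qed
qed

text \<open>One half of the Courant-Fischer principle: a subspace of dimension at least
  \<open>CARD('k) + 1\<close> meets the kernel of a map into a space of dimension
  \<open>CARD('k)\<close> in a nonzero vector, which would be stretched both by more than
  \<open>c\<close> and by at most \<open>c\<close>.\<close>

lemma sing_val_le_norm_on_kernel:
  fixes M :: "real^'n^'m" and f :: "real^'n \<Rightarrow> real^'k"
  assumes f: "linear f" and c: "0 \<le> c"
    and le: "\<And>x. f x = 0 \<Longrightarrow> norm (M *v x) \<le> c * norm x"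
  shows "sing_val M (CARD('k) + 1) \<le> c"
proof (rule ccontr)
  let ?s = "sing_val M (CARD('k) + 1)"
  assume "\<not> ?s \<le> c"
  then have less: "c < ?s" by simp
  then obtain E where E: "subspace E" "CARD('k) + 1 \<le> dim E"
    "\<And>x. x \<in> E \<Longrightarrow> ?s * norm x \<le> norm (M *v x)"
    using sing_val_eigenspan[of M "CARD('k) + 1"] c by (metis le_less_trans)
  have "\<not> inj_on f E"
  proof
    assume "inj_on f E"
    then have "dim (f ` E) = dim E"
      using f E(1) by (intro dim_image_eq) (auto simp: span_eq_iff[THEN iffD2])
    moreover have "dim (f ` E) \<le> CARD('k)"
      using dim_subset_UNIV[of "f ` E"] by simp
    ultimately show False
      using E(2) by simp
  qed
  then obtain x where x: "x \<in> E" "f x = 0" "x \<noteq> 0"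
    using linear_injective_on_subspace_0[OF f E(1)] by auto
  have "?s * norm x \<le> c * norm x"
    using E(3)[OF x(1)] le[OF x(2)] by simp
  then show False
    using x(3) less by simp
qed

text \<open>\<open>F\<close> is injective on the orthogonal complement \<open>P\<close> of its
  kernel, so \<open>dim P \<le> rank F \<le> j \<le> dim E\<close>; as \<open>E\<close> lies in
  \<open>P\<close>, the two coincide. The index may exceed the rank, which admits
  \<open>F = matrix_inv A ** B\<close> with \<open>j = rank B\<close>. An index out of range, such
  as 0, falls under the trivial case.\<close>

lemma sing_val_rank_le_norm:
  fixes F :: "real^'n^'m"
  assumes j: "rank F \<le> j" and x: "\<And>y. y \<in> ker F \<Longrightarrow> x \<bullet> y = 0"
  shows "sing_val F j * norm x \<le> norm (F *v x)"
proof (cases "sing_val F j = 0")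
  case False
  then have "0 < sing_val F j"
    using sing_val_nonneg[of F j] by simp
  then obtain E where E: "subspace E" "j \<le> dim E"
    "\<And>x. x \<in> E \<Longrightarrow> sing_val F j * norm x \<le> norm (F *v x)"
    "\<And>x y. x \<in> E \<Longrightarrow> y \<in> ker F \<Longrightarrow> x \<bullet> y = 0"
    using sing_val_eigenspan by blast
  define P where "P = {x. \<forall>y\<in>ker F. x \<bullet> y = 0}"
  have P: "subspace P"
    by (auto simp: P_def subspace_def inner_add_left)
  have "inj_on ((*v) F) P"
  proof (subst linear_injective_on_subspace_0[OF matrix_vector_mul_linear P], safe)
    fix x assume "x \<in> P" "F *v x = 0"
    then have "x \<bullet> x = 0"
      by (auto simp: P_def ker_def)
    then show "x = 0" by simp
  qed
  then have "dim P = dim ((*v) F ` P)"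
    using P by (intro dim_image_eq[symmetric] matrix_vector_mul_linear)
      (auto simp: span_eq_iff[THEN iffD2])
  also have "\<dots> \<le> rank F"
    by (simp add: rank_dim_range dim_subset image_mono)
  finally have "dim P \<le> dim E"
    using j E(2) by simp
  then have "E = P"
    using E P by (intro subspace_dim_equal) (auto simp: P_def)
  then show ?thesis
    using E(3) x by (auto simp: P_def)
qed simp

section \<open>Operator norms on the whole space and on subspaces\<close>

lemma norm_mult_le_op_norm: "norm (M *v x) \<le> op_norm M * norm x"
  for M :: "real^'n^'m"
  by (rule onorm) simp

lemma op_norm_nonneg: "0 \<le> op_norm M"
  for M :: "real^'n^'m"
  by (rule onorm_pos_le) simp

lemma op_norm_transpose_le: "op_norm (transpose M) \<le> op_norm M"
  for M :: "real^'n^'m"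
proof (rule onorm_le)
  fix x
  let ?y = "transpose M *v x"
  have "norm ?y * norm ?y = x \<bullet> (M *v ?y)"
    by (metis inner_transpose_mult power2_eq_square power2_norm_eq_inner)
  also have "\<dots> \<le> norm x * norm (M *v ?y)"
    by (rule norm_cauchy_schwarz)
  also have "\<dots> \<le> norm x * (op_norm M * norm ?y)"
    by (intro mult_left_mono norm_mult_le_op_norm) simp
  finally have "norm ?y * norm ?y \<le> (op_norm M * norm x) * norm ?y"
    by (simp add: mult_ac)
  then show "norm ?y \<le> op_norm M * norm x"
    by (cases "norm ?y = 0") (use op_norm_nonneg[of M] in auto)
qed

lemma op_norm_transpose: "op_norm (transpose M) = op_norm M"
  for M :: "real^'n^'m"
  using op_norm_transpose_le[of M] op_norm_transpose_le[of "transpose M"]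
  by (simp only: transpose_transpose)

text \<open>The supremum in \<open>onorm_on\<close> is one of reals, so it dominates its members
  only once the set is known to be bounded above.\<close>

lemma bdd_above_onorm_on:
  assumes "bounded_linear f"
  shows "bdd_above ((\<lambda>x. norm (f x) / norm x) ` S)"
  by (rule bdd_aboveI[of _ "onorm f"]) (auto intro: le_onorm[OF assms])

lemma norm_le_onorm_on:
  assumes f: "bounded_linear f" and x: "x \<in> S"
  shows "norm (f x) \<le> onorm_on S f * norm x"
proof (cases "x = 0")
  case True
  then show ?thesis
    using linear_0[OF bounded_linear.linear[OF f]] by simp
next
  case False
  have "norm (f x) / norm x \<le> onorm_on S f"
    unfolding onorm_on_def using x bdd_above_onorm_on[OF f] by (rule cSUP_upper)
  then show ?thesis
    using False by (simp add: pos_divide_le_eq)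
qed

lemma onorm_on_nonneg:
  assumes f: "bounded_linear f" and x: "x \<in> S"
  shows "0 \<le> onorm_on S f"
proof -
  have "0 \<le> norm (f x) / norm x"
    by simp
  also have "\<dots> \<le> onorm_on S f"
    unfolding onorm_on_def using x bdd_above_onorm_on[OF f] by (rule cSUP_upper)
  finally show ?thesis .
qed

lemma subspace_ker: "subspace (ker M)"
  by (auto simp: ker_def subspace_def matrix_vector_right_distrib matrix_vector_mult_scaleR)

section \<open>Block vectors and block matrices\<close>

definition Inl_part :: "real^('a::finite + 'b::finite) \<Rightarrow> real^'a" where
  "Inl_part x = (\<chi> i. x $ Inl i)"

definition Inr_part :: "real^('a::finite + 'b::finite) \<Rightarrow> real^'b" where
  "Inr_part x = (\<chi> i. x $ Inr i)"

lemma sum_UNIV_Plus: "(\<Sum>i\<in>UNIV. g i) = (\<Sum>i\<in>UNIV. g (Inl i)) + (\<Sum>i\<in>UNIV. g (Inr i))"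
  for g :: "'a::finite + 'b::finite \<Rightarrow> real"
  by (subst UNIV_Plus_UNIV[symmetric], subst sum.Plus) (auto simp: o_def)

lemma norm_parts: "(norm x)\<^sup>2 = (norm (Inl_part x))\<^sup>2 + (norm (Inr_part x))\<^sup>2"
  unfolding power2_norm_eq_inner
  by (simp add: inner_vec_def Inl_part_def Inr_part_def sum_UNIV_Plus)

lemma linear_Inl_part: "linear Inl_part"
  by (auto simp: Inl_part_def linear_iff vec_eq_iff)

lemma Inl_part_block_mat:
  "Inl_part (block_mat A B C D *v x) = A *v Inl_part x + B *v Inr_part x"
  by (simp add: Inl_part_def Inr_part_def block_mat_def matrix_vector_mult_def vec_eq_iff
      sum_UNIV_Plus)

lemma Inr_part_block_mat:
  "Inr_part (block_mat A B C D *v x) = C *v Inl_part x + D *v Inr_part x"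
  by (simp add: Inl_part_def Inr_part_def block_mat_def matrix_vector_mult_def vec_eq_iff
      sum_UNIV_Plus)

lemma transpose_block_mat:
  "transpose (block_mat A B C D) =
   block_mat (transpose A) (transpose C) (transpose B) (transpose D)"
  by (auto simp: transpose_def block_mat_def vec_eq_iff split: sum.splits)

section \<open>Scalar inequalities, and estimates on the kernel of the upper block row\<close>

text \<open>For \<open>s > 0\<close> this is monotonicity of \<open>t / sqrt (1 + t^2)\<close>
  between \<open>a\<close> and \<open>b / s\<close>. Clearing denominators and squaring avoids the
  division: the common term \<open>a^2 * b^2\<close> cancels and \<open>(a * s)^2 \<le> b^2\<close>
  remains.\<close>

lemma div_sqrt_one_plus_square_mono:
  fixes a b s :: real
  assumes "0 \<le> a" "0 \<le> s" "0 \<le> b" "a * s \<le> b" "0 < s \<or> 0 < b"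
  shows "a / sqrt (1 + a\<^sup>2) \<le> b / sqrt (s\<^sup>2 + b\<^sup>2)"
proof -
  have p: "0 < s\<^sup>2 + b\<^sup>2" "0 < 1 + a\<^sup>2"
    using assms by (auto simp: add_nonneg_pos add_pos_nonneg)
  have "(a * sqrt (s\<^sup>2 + b\<^sup>2))\<^sup>2 \<le> (b * sqrt (1 + a\<^sup>2))\<^sup>2"
    using power_mono[OF assms(4), of 2] assms p
    by (simp add: power_mult_distrib algebra_simps)
  then have "a * sqrt (s\<^sup>2 + b\<^sup>2) \<le> b * sqrt (1 + a\<^sup>2)"
    by (rule power2_le_imp_le) (use assms in auto)
  then show ?thesis
    using p by (simp add: divide_simps)
qed

lemma one_div_sqrt_one_plus_square_bounds:
  fixes t :: real
  shows "0 < 1 / sqrt (1 + t\<^sup>2)" "1 / sqrt (1 + t\<^sup>2) \<le> 1"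
  by (simp_all add: add_pos_nonneg)

text \<open>The source of the weight \<open>nu\<close>. Split \<open>v = y0 + y1\<close> with
  \<open>y0\<close> in \<open>K\<close> and \<open>y1\<close> orthogonal to \<open>K\<close>. Since
  \<open>F\<close> sees only \<open>y1\<close>, the square of the root on the right is at least
  \<open>norm y0 ^ 2 + (1 + s^2) * norm y1 ^ 2\<close>, which leaves room to lengthen
  \<open>y1\<close> by the factor \<open>1 / nu\<close>.\<close>

lemma norm_le_split_orthogonal:
  fixes D :: "real^'p^'q"
  assumes K: "subspace K" and s: "0 \<le> s"
    and F: "\<And>y. y \<in> K \<Longrightarrow> F *v y = 0"
    and low: "\<And>x. (\<And>y. y \<in> K \<Longrightarrow> x \<bullet> y = 0) \<Longrightarrow> s * norm x \<le> norm (F *v x)"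
    and nu: "nu = 1 / sqrt (1 + s\<^sup>2)"
  shows "norm (D *v v) \<le> (nu * op_norm D + (1 - nu) * onorm_on K (\<lambda>x. D *v x))
           * sqrt ((norm (F *v v))\<^sup>2 + (norm v)\<^sup>2)"
proof -
  have nu01: "0 < nu" "nu \<le> 1"
    unfolding nu by (rule one_div_sqrt_one_plus_square_bounds)+
  have nu2: "1 / nu\<^sup>2 = 1 + s\<^sup>2"
    unfolding nu by (simp add: power_divide add_nonneg_nonneg)
  obtain y0 y1 where y: "y0 \<in> span K" "\<And>w. w \<in> span K \<Longrightarrow> orthogonal y1 w" "v = y0 + y1"
    using orthogonal_subspace_decomp_exists[of K v] by blast
  have y0: "y0 \<in> K"
    using y(1) K by (simp add: span_eq_iff[THEN iffD2])
  have orth: "y1 \<bullet> w = 0" if "w \<in> K" for w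
    using y(2) that by (simp add: orthogonal_def span_base)
  have o: "y0 \<bullet> y1 = 0"
    using orth[OF y0] by (simp add: inner_commute)
  let ?N = "sqrt ((norm (F *v v))\<^sup>2 + (norm v)\<^sup>2)"
  have Fv: "F *v v = F *v y1"
    using F[OF y0] by (simp add: y(3) matrix_vector_right_distrib)
  have "(s * norm y1)\<^sup>2 \<le> (norm (F *v v))\<^sup>2"
    unfolding Fv using low[of y1] orth s by (intro power_mono) auto
  moreover have "(norm v)\<^sup>2 = (norm y0)\<^sup>2 + (norm y1)\<^sup>2"
    unfolding y(3) using o by (intro norm_add_Pythagorean) (simp add: orthogonal_def)
  ultimately have ge: "(norm y0)\<^sup>2 + (1 / nu\<^sup>2) * (norm y1)\<^sup>2 \<le> ?N\<^sup>2"
    unfolding nu2 by (simp add: power_mult_distrib algebra_simps)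
  have "norm (y0 + (1 / nu) *\<^sub>R y1) \<le> ?N"
  proof (rule power2_le_imp_le)
    have "(norm (y0 + (1 / nu) *\<^sub>R y1))\<^sup>2 = (norm y0)\<^sup>2 + (norm ((1 / nu) *\<^sub>R y1))\<^sup>2"
      using o by (intro norm_add_Pythagorean) (simp add: orthogonal_def)
    also have "\<dots> = (norm y0)\<^sup>2 + (1 / nu\<^sup>2) * (norm y1)\<^sup>2"
      by (simp add: power_divide)
    finally show "(norm (y0 + (1 / nu) *\<^sub>R y1))\<^sup>2 \<le> ?N\<^sup>2"
      using ge by simp
  qed simp
  then have a: "norm (D *v (y0 + (1 / nu) *\<^sub>R y1)) \<le> op_norm D * ?N"
    using norm_mult_le_op_norm[of D] op_norm_nonneg[of D]
    by (meson mult_left_mono order_trans)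
  have "norm y0 \<le> ?N"
  proof (rule power2_le_imp_le)
    have "0 \<le> (1 / nu\<^sup>2) * (norm y1)\<^sup>2"
      by simp
    then show "(norm y0)\<^sup>2 \<le> ?N\<^sup>2"
      using ge by linarith
  qed simp
  then have b: "norm (D *v y0) \<le> onorm_on K (\<lambda>x. D *v x) * ?N"
    using norm_le_onorm_on[OF matrix_vector_mul_bounded_linear y0, of D]
      onorm_on_nonneg[OF matrix_vector_mul_bounded_linear y0, of D]
    by (meson mult_left_mono order_trans)
  \<comment> \<open>Writing \<open>v\<close> as this convex combination charges the norm of \<open>D\<close> only with weight \<open>nu\<close>.\<close>
  have "v = nu *\<^sub>R (y0 + (1 / nu) *\<^sub>R y1) + (1 - nu) *\<^sub>R y0"
    using nu01 by (simp add: y(3) algebra_simps)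
  then have "D *v v = nu *\<^sub>R (D *v (y0 + (1 / nu) *\<^sub>R y1)) + (1 - nu) *\<^sub>R (D *v y0)"
    by (metis matrix_vector_right_distrib matrix_vector_mult_scaleR)
  then have "norm (D *v v) \<le> nu * norm (D *v (y0 + (1 / nu) *\<^sub>R y1)) + (1 - nu) * norm (D *v y0)"
    using norm_triangle_ineq[of "nu *\<^sub>R (D *v (y0 + (1 / nu) *\<^sub>R y1))" "(1 - nu) *\<^sub>R (D *v y0)"] nu01
    by simp
  also have "\<dots> \<le> nu * (op_norm D * ?N) + (1 - nu) * (onorm_on K (\<lambda>x. D *v x) * ?N)"
    using a b nu01 by (intro add_mono mult_left_mono) auto
  finally show ?thesis
    by (simp add: algebra_simps)
qed

text \<open>With \<open>v = Inr_part z\<close>, the hypothesis on \<open>z\<close> forces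
  \<open>Inl_part z = - (F *v v)\<close>, and the image has lower part
  \<open>D *v v - C *v (F *v v)\<close>. Giving \<open>F\<close> by \<open>A ** F = B\<close> and
  \<open>s\<close> as any lower bound off the kernel lets the lemma serve the transposed matrix too,
  with \<open>s\<close> still a singular value of the untransposed
  \<open>C ** matrix_inv A\<close>.\<close>

lemma norm_block_mat_le:
  fixes A :: "real^'k^'k" and B :: "real^'p^'k" and C :: "real^'k^'q" and D :: "real^'p^'q"
  assumes A: "invertible A" and F: "A ** F = B" and s: "0 \<le> s"
    and low: "\<And>x. (\<And>y. y \<in> ker F \<Longrightarrow> x \<bullet> y = 0) \<Longrightarrow> s * norm x \<le> norm (F *v x)"
    and nu: "nu = 1 / sqrt (1 + s\<^sup>2)"
    and z: "Inl_part (block_mat A B C D *v z) = 0"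
  shows "norm (block_mat A B C D *v z)
    \<le> (op_norm F / sqrt (1 + (op_norm F)\<^sup>2) * op_norm C
        + (nu * op_norm D + (1 - nu) * onorm_on (ker B) (\<lambda>x. D *v x))) * norm z"
proof -
  define v where "v = Inr_part z"
  have injA: "inj ((*v) A)"
    using A by (rule inj_matrix_vector_mult)
  have "A *v (Inl_part z + F *v v) = 0"
    using z by (simp add: Inl_part_block_mat v_def matrix_vector_right_distrib
        matrix_vector_mul_assoc F)
  then have "Inl_part z + F *v v = 0"
    using injA by (metis injD matrix_vector_mult_0_right)
  then have u: "Inl_part z = - (F *v v)"
    by (simp add: add_eq_0_iff2)
  \<comment> \<open>The splitting estimate is about \<open>ker F\<close>, the conclusion about
    \<open>ker B\<close>; injectivity of \<open>A\<close> identifies them.\<close>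
  have "ker F = ker B"
    using injA by (auto simp: ker_def simp flip: F matrix_vector_mul_assoc)
      (metis injD matrix_vector_mult_0_right)
  have N: "norm z = sqrt ((norm (F *v v))\<^sup>2 + (norm v)\<^sup>2)"
    using norm_parts[of z] u by (simp add: v_def real_sqrt_unique)
  have Dv: "norm (D *v v) \<le> (nu * op_norm D + (1 - nu) * onorm_on (ker B) (\<lambda>x. D *v x)) * norm z"
    unfolding N \<open>ker F = ker B\<close>[symmetric]
    by (rule norm_le_split_orthogonal[OF subspace_ker s _ low nu]) (auto simp: ker_def)
  let ?t = "op_norm F"
  have Fv: "norm (F *v v) \<le> ?t / sqrt (1 + ?t\<^sup>2) * norm z"
  proof (rule power2_le_imp_le)
    have "(norm (F *v v))\<^sup>2 \<le> ?t\<^sup>2 * (norm v)\<^sup>2"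
      using power_mono[OF norm_mult_le_op_norm[of F v], of 2] by (simp add: power_mult_distrib)
    \<comment> \<open>Both sides gain \<open>op_norm F ^ 2 * norm (F *v v) ^ 2\<close>, which
      completes \<open>norm v ^ 2\<close> to \<open>norm z ^ 2\<close> on the right.\<close>
    then have "(norm (F *v v))\<^sup>2 * (1 + ?t\<^sup>2) \<le> ?t\<^sup>2 * (norm z)\<^sup>2"
      unfolding N by (simp add: algebra_simps)
    moreover have "0 < 1 + ?t\<^sup>2"
      by (simp add: add_pos_nonneg)
    ultimately show "(norm (F *v v))\<^sup>2 \<le> (?t / sqrt (1 + ?t\<^sup>2) * norm z)\<^sup>2"
      by (simp add: power_mult_distrib power_divide pos_le_divide_eq)
  qed (use op_norm_nonneg[of F] in simp)
  let ?y = "block_mat A B C D *v z"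
  have y: "Inr_part ?y = D *v v - C *v (F *v v)"
    by (simp add: Inr_part_block_mat u v_def linear_neg[OF matrix_vector_mul_linear])
  have "(norm ?y)\<^sup>2 = (norm (Inr_part ?y))\<^sup>2"
    using norm_parts[of ?y] z by simp
  then have "norm ?y = norm (D *v v - C *v (F *v v))"
    by (simp add: y)
  also have "\<dots> \<le> norm (D *v v) + norm (C *v (F *v v))"
    by (rule norm_triangle_ineq4)
  also have "norm (C *v (F *v v)) \<le> op_norm C * (?t / sqrt (1 + ?t\<^sup>2) * norm z)"
    by (rule order_trans[OF norm_mult_le_op_norm]) (intro mult_left_mono Fv op_norm_nonneg)
  finally show ?thesis
    using Dv by (simp add: algebra_simps)
qed

section \<open>Passing to the transpose\<close>

text \<open>The singular values of \<open>M\<close> and its transpose need not be compared. If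
  \<open>f\<close> kills \<open>M *v x\<close>, then \<open>norm (M *v x) ^ 2\<close> is the inner
  product of \<open>transpose M *v (M *v x)\<close> with \<open>x\<close>, hence at most
  \<open>c * norm (M *v x) * norm x\<close>, and one factor cancels.\<close>

lemma sing_val_le_transpose:
  fixes M :: "real^'n^'m" and f :: "real^'m \<Rightarrow> real^'k"
  assumes f: "linear f" and c: "0 \<le> c"
    and le: "\<And>y. f y = 0 \<Longrightarrow> norm (transpose M *v y) \<le> c * norm y"
  shows "sing_val M (CARD('k) + 1) \<le> c"
proof (rule sing_val_le_norm_on_kernel)
  show "linear (f \<circ> (*v) M)"
    using f by (intro linear_compose matrix_vector_mul_linear)
  fix x assume "(f \<circ> (*v) M) x = 0"
  then have "norm (transpose M *v (M *v x)) \<le> c * norm (M *v x)"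
    by (intro le) simp
  then have "norm x * norm (transpose M *v (M *v x)) \<le> norm x * (c * norm (M *v x))"
    by (rule mult_left_mono) simp
  moreover have "(M *v x) \<bullet> (M *v x) = (transpose M *v (M *v x)) \<bullet> x"
    by (simp only: inner_transpose_mult)
  then have "norm (M *v x) * norm (M *v x) \<le> norm x * norm (transpose M *v (M *v x))"
    using norm_cauchy_schwarz[of "transpose M *v (M *v x)" x]
    by (simp add: mult.commute flip: power2_norm_eq_inner power2_eq_square del: transpose_matrix_vector)
  ultimately have "norm (M *v x) * norm (M *v x) \<le> (c * norm x) * norm (M *v x)"
    by (simp add: mult_ac del: transpose_matrix_vector)
  then show "norm (M *v x) \<le> c * norm x"
    by (cases "norm (M *v x) = 0") (use c in auto)
qed (fact c)

text \<open>A vector orthogonal to the kernel of the transpose lies in the range, which reduces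
  the claim to the bound for \<open>G\<close> itself.\<close>

lemma sing_val_rank_le_norm_transpose:
  fixes G :: "real^'n^'m"
  assumes j: "rank G \<le> j" and x: "\<And>y. y \<in> ker (transpose G) \<Longrightarrow> x \<bullet> y = 0"
  shows "sing_val G j * norm x \<le> norm (transpose G *v x)"
proof -
  have "subspace (range ((*v) G))"
    by (intro linear_subspace_image matrix_vector_mul_linear) simp
  then obtain g h where gh: "g \<in> range ((*v) G)" "\<And>w. w \<in> range ((*v) G) \<Longrightarrow> h \<bullet> w = 0" "x = g + h"
    using orthogonal_subspace_decomp_exists[of "range ((*v) G)" x]
    by (metis orthogonal_def span_eq_iff)
  have "(transpose G *v h) \<bullet> (transpose G *v h) = h \<bullet> (G *v (transpose G *v h))"
    by (rule inner_transpose_mult)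
  then have "h \<in> ker (transpose G)"
    using gh(2) by (simp add: ker_def del: transpose_matrix_vector)
  then have "x \<bullet> h = 0" "g \<bullet> h = 0"
    using x gh(1,2) by (auto simp: inner_commute)
  then have "h = 0"
    by (simp add: gh(3) inner_add_left)
  then obtain w where w: "x = G *v w"
    using gh by auto
  \<comment> \<open>Removing the component in \<open>ker G\<close> does not change the image
    \<open>x\<close>, and makes the bound for \<open>G\<close> applicable to the preimage
    \<open>w1\<close>.\<close>
  obtain w0 w1 where ww: "w0 \<in> span (ker G)" "\<And>y. y \<in> span (ker G) \<Longrightarrow> orthogonal w1 y" "w = w0 + w1"
    using orthogonal_subspace_decomp_exists[of "ker G" w] by blast
  have "w0 \<in> ker G"
    using ww(1) subspace_ker[of G] by (simp add: span_eq_iff[THEN iffD2])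
  then have xw: "x = G *v w1"
    by (simp add: w ww(3) ker_def matrix_vector_right_distrib)
  have low: "sing_val G j * norm w1 \<le> norm x"
    unfolding xw using j ww(2) by (intro sing_val_rank_le_norm) (auto simp: orthogonal_def span_base)
  show ?thesis
  proof (cases "w1 = 0")
    case False
    have "(sing_val G j * norm x) * norm w1 \<le> norm x * norm x"
      using mult_left_mono[OF low, of "norm x"] by (simp add: mult_ac)
    also have "\<dots> = x \<bullet> (G *v w1)"
      by (simp add: xw flip: power2_norm_eq_inner power2_eq_square)
    also have "\<dots> = (transpose G *v x) \<bullet> w1"
      by (simp only: inner_transpose_mult)
    also have "\<dots> \<le> norm (transpose G *v x) * norm w1"
      by (rule norm_cauchy_schwarz)
    finally show ?thesis
      using False by simp
  qed (simp add: xw)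
qed

section \<open>The weights \<open>nu1\<close>, \<open>nu2\<close> and the quantities
  \<open>rho1\<close>, \<open>rho2\<close>\<close>

lemma nu1_bounds: "0 < nu1 A B" "nu1 A B \<le> 1"
  unfolding nu1_def by (rule one_div_sqrt_one_plus_square_bounds)+

lemma nu2_bounds: "0 < nu2 A C" "nu2 A C \<le> 1"
  unfolding nu2_def by (rule one_div_sqrt_one_plus_square_bounds)+

lemma zero_in_ker: "0 \<in> ker M"
  by (simp add: ker_def)

lemma rho1_nonneg: "0 \<le> rho1 A B D"
  unfolding rho1_def using nu1_bounds[of A B]
  by (intro add_nonneg_nonneg mult_nonneg_nonneg op_norm_nonneg
      onorm_on_nonneg[OF matrix_vector_mul_bounded_linear zero_in_ker]) auto

lemma rho2_nonneg: "0 \<le> rho2 A C D"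
  unfolding rho2_def using nu2_bounds[of A C]
  by (intro add_nonneg_nonneg mult_nonneg_nonneg op_norm_nonneg
      onorm_on_nonneg[OF matrix_vector_mul_bounded_linear zero_in_ker]) auto

lemma onorm_on_ker_zero: "onorm_on (ker M) (\<lambda>x. 0) = 0"
  using zero_in_ker[of M] by (auto simp: onorm_on_def intro!: cSUP_const)

text \<open>Makes the bounds for \<open>block_mat A B C 0\<close> the case \<open>D = 0\<close> of
  the general ones.\<close>

lemma rho_zero:
  fixes A :: "real^'k^'k" and B :: "real^'p^'k" and C :: "real^'k^'q"
  shows "rho1 A B (0 :: real^'p^'q) = 0" "rho2 A C (0 :: real^'p^'q) = 0"
proof -
  have "transpose (0 :: real^'p^'q) = 0"
    by (simp add: transpose_def vec_eq_iff)
  then show "rho1 A B (0 :: real^'p^'q) = 0" "rho2 A C (0 :: real^'p^'q) = 0"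
    by (simp_all add: rho1_def rho2_def onorm_zero onorm_on_ker_zero del: transpose_matrix_vector)
qed

section \<open>The two bounds for a block matrix with invertible corner\<close>

lemma matrix_inv_inverse:
  fixes A :: "real^'k^'k"
  assumes "invertible A"
  shows "A ** matrix_inv A = mat 1" "matrix_inv A ** A = mat 1"
  using someI_ex[OF assms[unfolded invertible_def]] by (simp_all add: matrix_inv_def)

lemma matrix_inv_cancel:
  fixes A :: "real^'k^'k"
  assumes "invertible A"
  shows "A ** (matrix_inv A ** X) = X" "(Y ** matrix_inv A) ** A = Y"
  using matrix_inv_inverse[OF assms] by (simp add: matrix_mul_assoc, simp flip: matrix_mul_assoc)

lemma sing_val_block_mat_le_rho1:
  fixes A :: "real^'k^'k" and B :: "real^'p^'k" and C :: "real^'k^'q" and D :: "real^'p^'q"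
  assumes A: "invertible A"
  shows "sing_val (block_mat A B C D) (CARD('k) + 1)
    \<le> op_norm (matrix_inv A ** B) / sqrt (1 + (op_norm (matrix_inv A ** B))\<^sup>2) * op_norm C
        + rho1 A B D"
proof (rule sing_val_le_norm_on_kernel)
  show "linear (Inl_part \<circ> (*v) (block_mat A B C D))"
    by (intro linear_compose matrix_vector_mul_linear linear_Inl_part)
  show "0 \<le> op_norm (matrix_inv A ** B) / sqrt (1 + (op_norm (matrix_inv A ** B))\<^sup>2) * op_norm C
        + rho1 A B D"
    by (intro add_nonneg_nonneg rho1_nonneg mult_nonneg_nonneg divide_nonneg_nonneg op_norm_nonneg) auto
  fix z assume "(Inl_part \<circ> (*v) (block_mat A B C D)) z = 0"
  then show "norm (block_mat A B C D *v z)
    \<le> (op_norm (matrix_inv A ** B) / sqrt (1 + (op_norm (matrix_inv A ** B))\<^sup>2) * op_norm C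
        + rho1 A B D) * norm z"
    unfolding rho1_def
    \<comment> \<open>Here \<open>s\<close> is the singular value of
      \<open>matrix_inv A ** B\<close> at index \<open>rank B\<close>, admissible because the
      product has rank at most \<open>rank B\<close>.\<close>
    by (intro norm_block_mat_le[OF A matrix_inv_cancel(1)[OF A] sing_val_nonneg _ nu1_def]
        sing_val_rank_le_norm rank_mul_le_right) auto
qed

lemma sing_val_block_mat_le_rho2:
  fixes A :: "real^'k^'k" and B :: "real^'p^'k" and C :: "real^'k^'q" and D :: "real^'p^'q"
  assumes A: "invertible A"
  shows "sing_val (block_mat A B C D) (CARD('k) + 1)
    \<le> op_norm (C ** matrix_inv A) / sqrt (1 + (op_norm (C ** matrix_inv A))\<^sup>2) * op_norm B
        + rho2 A C D"
proof (rule sing_val_le_transpose)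
  let ?R = "block_mat (transpose A) (transpose C) (transpose B) (transpose D)"
  let ?G = "C ** matrix_inv A"
  show "linear (Inl_part \<circ> (*v) ?R)"
    by (intro linear_compose matrix_vector_mul_linear linear_Inl_part)
  show "0 \<le> op_norm ?G / sqrt (1 + (op_norm ?G)\<^sup>2) * op_norm B + rho2 A C D"
    by (intro add_nonneg_nonneg rho2_nonneg mult_nonneg_nonneg divide_nonneg_nonneg op_norm_nonneg) auto
  have tA: "invertible (transpose A)"
    using A by (rule transpose_invertible)
  \<comment> \<open>The transpose of \<open>C ** matrix_inv A\<close> plays the role of
    \<open>F\<close>, so no formula for the inverse of \<open>transpose A\<close> is
    required.\<close>
  have tF: "transpose A ** transpose ?G = transpose C"
    using matrix_inv_cancel(2)[OF A, of C] by (simp flip: matrix_transpose_mul)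
  fix z assume "(Inl_part \<circ> (*v) ?R) z = 0"
  then have z: "Inl_part (?R *v z) = 0"
    by simp
  have "norm (?R *v z) \<le> (op_norm (transpose ?G) / sqrt (1 + (op_norm (transpose ?G))\<^sup>2)
      * op_norm (transpose B) + (nu2 A C * op_norm (transpose D)
        + (1 - nu2 A C) * onorm_on (ker (transpose C)) (\<lambda>x. transpose D *v x))) * norm z"
    by (rule norm_block_mat_le[OF tA tF sing_val_nonneg _ nu2_def z])
      (intro sing_val_rank_le_norm_transpose rank_mul_le_left, blast)
  then show "norm (transpose (block_mat A B C D) *v z)
    \<le> (op_norm ?G / sqrt (1 + (op_norm ?G)\<^sup>2) * op_norm B + rho2 A C D) * norm z"
    by (simp only: op_norm_transpose transpose_block_mat rho2_def)
qed

section \<open>Comparison with the singular value number k of \<open>A\<close>\<close>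

lemma sing_val_mult_norm_le_invertible:
  fixes A :: "real^'k^'k"
  assumes "invertible A"
  shows "sing_val A CARD('k) * norm x \<le> norm (A *v x)"
proof (rule sing_val_rank_le_norm)
  show "rank A \<le> CARD('k)"
    using rank_bound[of A] by simp
  show "x \<bullet> y = 0" if "y \<in> ker A" for y
  proof -
    have "y = 0"
      using that inj_matrix_vector_mult[OF assms] unfolding ker_def
      by (metis (mono_tags, lifting) injD matrix_vector_mult_0_right mem_Collect_eq)
    then show ?thesis by simp
  qed
qed

text \<open>\<open>A\<close> stretches every vector by at least its singular value number
  \<open>CARD('k)\<close>, and maps \<open>matrix_inv A ** B\<close> back to \<open>B\<close>. In
  product form a zero singular value is a trivial case.\<close>

lemma op_norm_inv_mult_le:
  fixes A :: "real^'k^'k" and B :: "real^'p^'k"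
  assumes A: "invertible A"
  shows "op_norm (matrix_inv A ** B) * sing_val A CARD('k) \<le> op_norm B"
proof (cases "sing_val A CARD('k) = 0")
  case False
  then have s: "0 < sing_val A CARD('k)"
    using sing_val_nonneg[of A] by (simp add: less_le)
  have "op_norm (matrix_inv A ** B) \<le> op_norm B / sing_val A CARD('k)"
  proof (rule onorm_le)
    fix x
    have "sing_val A CARD('k) * norm ((matrix_inv A ** B) *v x)
        \<le> norm (A *v ((matrix_inv A ** B) *v x))"
      by (rule sing_val_mult_norm_le_invertible[OF A])
    also have "\<dots> = norm (B *v x)"
      by (simp only: matrix_vector_mul_assoc matrix_inv_cancel(1)[OF A])
    also have "\<dots> \<le> op_norm B * norm x"
      by (rule norm_mult_le_op_norm)
    finally show "norm ((matrix_inv A ** B) *v x) \<le> op_norm B / sing_val A CARD('k) * norm x"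
      using s by (simp add: pos_le_divide_eq mult_ac)
  qed
  then show ?thesis
    using s by (simp add: pos_le_divide_eq)
qed (simp add: op_norm_nonneg)

lemma op_norm_mult_inv_le:
  fixes A :: "real^'k^'k" and C :: "real^'k^'q"
  assumes A: "invertible A"
  shows "op_norm (C ** matrix_inv A) * sing_val A CARD('k) \<le> op_norm C"
proof (cases "sing_val A CARD('k) = 0")
  case False
  then have s: "0 < sing_val A CARD('k)"
    using sing_val_nonneg[of A] by (simp add: less_le)
  have "op_norm (C ** matrix_inv A) \<le> op_norm C / sing_val A CARD('k)"
  proof (rule onorm_le)
    fix x
    let ?y = "matrix_inv A *v x"
    have "A *v ?y = x"
      using matrix_inv_inverse(1)[OF A] by (simp add: matrix_vector_mul_assoc)
    then have "sing_val A CARD('k) * norm ?y \<le> norm x"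
      using sing_val_mult_norm_le_invertible[OF A, of ?y] by simp
    then have "norm ?y \<le> norm x / sing_val A CARD('k)"
      using s by (simp add: pos_le_divide_eq mult_ac)
    then have "op_norm C * norm ?y \<le> op_norm C * (norm x / sing_val A CARD('k))"
      by (intro mult_left_mono op_norm_nonneg)
    then show "norm ((C ** matrix_inv A) *v x) \<le> op_norm C / sing_val A CARD('k) * norm x"
      using norm_mult_le_op_norm[of C ?y] by (simp add: matrix_vector_mul_assoc)
  qed
  then show ?thesis
    using s by (simp add: pos_le_divide_eq)
qed (simp add: op_norm_nonneg)

text \<open>It suffices to bound one of the two terms: the one with \<open>a\<close> if
  \<open>c \<le> b\<close>, the one with \<open>g\<close> otherwise. The larger of \<open>b\<close>
  and \<open>c\<close> then stands under the root. If \<open>b\<close> or \<open>c\<close> is 0, one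
  term and the right side both vanish.\<close>

lemma min_product_le:
  fixes a b c g s :: real
  assumes nonneg: "0 \<le> a" "0 \<le> b" "0 \<le> c" "0 \<le> g" "0 \<le> s"
    and "a * s \<le> b" "g * s \<le> c"
  shows "min (g / sqrt (1 + g\<^sup>2) * b) (a / sqrt (1 + a\<^sup>2) * c)
    \<le> b * c / sqrt (s\<^sup>2 + (max b c)\<^sup>2)"
proof (cases "b = 0 \<or> c = 0")
  case False
  then have pos: "0 < b" "0 < c"
    using nonneg by auto
  show ?thesis
  proof (cases "c \<le> b")
    case True
    have "a / sqrt (1 + a\<^sup>2) * c \<le> b / sqrt (s\<^sup>2 + b\<^sup>2) * c"
      using assms pos by (intro mult_right_mono div_sqrt_one_plus_square_mono) auto
    then show ?thesis
      using True by (simp add: min_le_iff_disj max_def)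
  next
    case False
    have "g / sqrt (1 + g\<^sup>2) * b \<le> c / sqrt (s\<^sup>2 + c\<^sup>2) * b"
      using assms pos by (intro mult_right_mono div_sqrt_one_plus_square_mono) auto
    then show ?thesis
      using False by (simp add: min_le_iff_disj max_def mult.commute)
  qed
qed (auto simp: min_def)

theorem theorem2:
  fixes A :: "real^'k^'k" and B :: "real^'p^'k" and C :: "real^'k^'q" and D :: "real^'p^'q"
  assumes "CARD('k + 'p) \<le> CARD('k + 'q)"
    and "invertible A"
  shows "sing_val (block_mat A B C 0) (CARD('k) + 1)
       \<le> min (op_norm (C ** matrix_inv A) / sqrt (1 + (op_norm (C ** matrix_inv A))\<^sup>2) * op_norm B)
             (op_norm (matrix_inv A ** B) / sqrt (1 + (op_norm (matrix_inv A ** B))\<^sup>2) * op_norm C)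
    \<and> min (op_norm (C ** matrix_inv A) / sqrt (1 + (op_norm (C ** matrix_inv A))\<^sup>2) * op_norm B)
          (op_norm (matrix_inv A ** B) / sqrt (1 + (op_norm (matrix_inv A ** B))\<^sup>2) * op_norm C)
       \<le> op_norm B * op_norm C
           / sqrt ((sing_val A CARD('k))\<^sup>2 + (max (op_norm B) (op_norm C))\<^sup>2)
    \<and> sing_val (block_mat A B C D) (CARD('k) + 1)
       \<le> min (op_norm (C ** matrix_inv A) / sqrt (1 + (op_norm (C ** matrix_inv A))\<^sup>2) * op_norm B
                + rho2 A C D)
             (op_norm (matrix_inv A ** B) / sqrt (1 + (op_norm (matrix_inv A ** B))\<^sup>2) * op_norm C
                + rho1 A B D)"
proof (intro conjI)
  have R0: "sing_val (block_mat A B C 0) (CARD('k) + 1)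
      \<le> op_norm (C ** matrix_inv A) / sqrt (1 + (op_norm (C ** matrix_inv A))\<^sup>2) * op_norm B"
    "sing_val (block_mat A B C 0) (CARD('k) + 1)
      \<le> op_norm (matrix_inv A ** B) / sqrt (1 + (op_norm (matrix_inv A ** B))\<^sup>2) * op_norm C"
    using sing_val_block_mat_le_rho2[OF assms(2), of B C 0]
      sing_val_block_mat_le_rho1[OF assms(2), of B C 0]
    by (simp_all add: rho_zero)
  show "sing_val (block_mat A B C 0) (CARD('k) + 1)
       \<le> min (op_norm (C ** matrix_inv A) / sqrt (1 + (op_norm (C ** matrix_inv A))\<^sup>2) * op_norm B)
             (op_norm (matrix_inv A ** B) / sqrt (1 + (op_norm (matrix_inv A ** B))\<^sup>2) * op_norm C)"
    using R0 by (rule min.boundedI)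
  show "min (op_norm (C ** matrix_inv A) / sqrt (1 + (op_norm (C ** matrix_inv A))\<^sup>2) * op_norm B)
          (op_norm (matrix_inv A ** B) / sqrt (1 + (op_norm (matrix_inv A ** B))\<^sup>2) * op_norm C)
       \<le> op_norm B * op_norm C
           / sqrt ((sing_val A CARD('k))\<^sup>2 + (max (op_norm B) (op_norm C))\<^sup>2)"
    by (intro min_product_le op_norm_nonneg sing_val_nonneg
        op_norm_inv_mult_le[OF assms(2)] op_norm_mult_inv_le[OF assms(2)])
  show "sing_val (block_mat A B C D) (CARD('k) + 1)
       \<le> min (op_norm (C ** matrix_inv A) / sqrt (1 + (op_norm (C ** matrix_inv A))\<^sup>2) * op_norm B
                + rho2 A C D)
             (op_norm (matrix_inv A ** B) / sqrt (1 + (op_norm (matrix_inv A ** B))\<^sup>2) * op_norm C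
                + rho1 A B D)"
    using sing_val_block_mat_le_rho2[OF assms(2)] sing_val_block_mat_le_rho1[OF assms(2)]
    by (rule min.boundedI)
qed

end
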